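(* Let $D \ge 1$, $\mathcal{B} = [0,1]^D$, let $f : \mathcal{B} \to \mathbb{R}$ be continuous and bounded, and let $\xi : \mathcal{B} \to \mathbb{R}$ be continuous, with a unique global minimizer $\mathbf{x}^s \in \mathcal{B}$, minimum value $s_l = \xi(\mathbf{x}^s)$ and maximum value $s_u$. For $\theta \in [s_l, s_u]$ define $$h(\theta) = \max\{ f(\mathbf{x}) : \mathbf{x} \in \mathcal{B},\ \xi(\mathbf{x}) = \theta \},$$ and for $\lambda > 0$ define $g(\mathbf{x};\lambda) = f(\mathbf{x}) - \lambda\, \xi(\mathbf{x})$ for $\mathbf{x} \in \mathcal{B}$. Let $I \subseteq [s_l, s_u]$ be an interval on which $h$ is strictly convex, and let $\theta$ be a point in the interior of $I$. Then, for every $\lambda > 0$, there is no maximizer $\mathbf{x}$ of $g(\cdot\,;\lambda)$ over $\mathcal{B}$ with $\xi(\mathbf{x}) = \theta$.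
   Context: Here $f$ is the objective function to be maximized and $\xi$ is a sparsity penalty (smaller values mean sparser). The function $g$ is the internally regularized objective, and $h(\theta)$ is the optimal objective value at sparsity level $\theta$. A maximizer of $g(\cdot\,;\lambda)$ is a point $\mathbf{x} \in \mathcal{B}$ with $g(\mathbf{x};\lambda) \ge g(\mathbf{y};\lambda)$ for all $\mathbf{y} \in \mathcal{B}$. *)

theory Defs
  imports "HOL-Analysis.Analysis"
begin

definition unit_cube :: "(real ^ 'n) set" where
  "unit_cube = cbox 0 1"

lemma mem_unit_cube_iff: "x \<in> unit_cube \<longleftrightarrow> (\<forall>i. 0 \<le> x $ i \<and> x $ i \<le> 1)"
  by (simp add: unit_cube_def mem_box_cart)

definition is_maximizer_on :: "'a set \<Rightarrow> ('a \<Rightarrow> real) \<Rightarrow> 'a \<Rightarrow> bool" where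
  "is_maximizer_on S F x \<longleftrightarrow> x \<in> S \<and> (\<forall>y\<in>S. F x \<ge> F y)"

definition is_minimizer_on :: "'a set \<Rightarrow> ('a \<Rightarrow> real) \<Rightarrow> 'a \<Rightarrow> bool" where
  "is_minimizer_on S F x \<longleftrightarrow> x \<in> S \<and> (\<forall>y\<in>S. F x \<le> F y)"

definition strictly_convex_on :: "real set \<Rightarrow> (real \<Rightarrow> real) \<Rightarrow> bool" where
  "strictly_convex_on S F \<longleftrightarrow> convex S \<and>
     (\<forall>x\<in>S. \<forall>y\<in>S. \<forall>t. x \<noteq> y \<longrightarrow> 0 < t \<longrightarrow> t < 1 \<longrightarrow>
        F ((1 - t) * x + t * y) < (1 - t) * F x + t * F y)"

(* Max is only meaningful for finite sets.  GREATEST denotes the maximum, i.e. the largest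
   element that is attained; it is unspecified when no maximum exists. *)

definition max_value :: "(real ^ 'n \<Rightarrow> real) \<Rightarrow> real" where
  "max_value \<xi> = (GREATEST v. v \<in> \<xi> ` unit_cube)"

definition h :: "(real ^ 'n \<Rightarrow> real) \<Rightarrow> (real ^ 'n \<Rightarrow> real) \<Rightarrow> real \<Rightarrow> real" where
  "h f \<xi> \<theta> = (GREATEST v. v \<in> f ` {x \<in> unit_cube. \<xi> x = \<theta>})"

definition g :: "(real ^ 'n \<Rightarrow> real) \<Rightarrow> (real ^ 'n \<Rightarrow> real) \<Rightarrow> real \<Rightarrow> real ^ 'n \<Rightarrow> real" where
  "g f \<xi> lam x = f x - lam * \<xi> x"

end

theory Submission
  imports Defs
begin

text \<open>A maximizer \<open>x\<close> of \<open>g\<close> with \<open>\<xi> x = \<theta>\<close> makes \<open>t \<mapsto> h \<theta> + lam * (t - \<theta>)\<close> an affine majorant of \<open>h\<close>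
  that touches \<open>h\<close> at the interior point \<open>\<theta>\<close>, which strict convexity excludes: compare with the
  midpoint inequality for \<open>\<theta> - e\<close> and \<open>\<theta> + e\<close>. The cube being compact and connected,
  \<open>h\<close> really is an attained maximum at every level between the extreme values of \<open>\<xi>\<close>.\<close>

text \<open>Compactness supplies an attained supremum, so \<open>GREATEST\<close>, otherwise
  unspecified, is a true maximum here; this covers both \<open>max_value\<close> and
  \<open>h\<close>.\<close>

lemma Greatest_compact:
  fixes S :: "real set"
  assumes "compact S" and "S \<noteq> {}"
  shows Greatest_mem_compact: "(GREATEST v. v \<in> S) \<in> S"
    and Greatest_upper_compact: "\<And>w. w \<in> S \<Longrightarrow> w \<le> (GREATEST v. v \<in> S)"
proof -
  obtain m where m: "m \<in> S" "\<And>w. w \<in> S \<Longrightarrow> w \<le> m"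
    using compact_attains_sup[OF assms] by blast
  then have "(GREATEST v. v \<in> S) = m"
    by (intro Greatest_equality) auto
  with m show "(GREATEST v. v \<in> S) \<in> S" "\<And>w. w \<in> S \<Longrightarrow> w \<le> (GREATEST v. v \<in> S)"
    by auto
qed

lemma compact_unit_cube: "compact unit_cube"
  by (simp add: unit_cube_def compact_cbox)

lemma connected_unit_cube: "connected unit_cube"
  by (simp add: unit_cube_def convex_connected convex_box)

lemma unit_cube_nonempty: "unit_cube \<noteq> {}"
proof -
  have "0 \<in> unit_cube" by (simp add: mem_unit_cube_iff)
  then show ?thesis by blast
qed

text \<open>Intermediate value argument: the image of the connected cube contains
  \<open>\<xi> x\<close> and the attained maximum, hence everything between. It is applied with
  \<open>x\<close> the minimizer \<open>xs\<close>.\<close>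

lemma level_nonempty:
  assumes "continuous_on unit_cube \<xi>" and "x \<in> unit_cube" and "t \<in> {\<xi> x..max_value \<xi>}"
  shows "t \<in> \<xi> ` unit_cube"
proof -
  have "max_value \<xi> \<in> \<xi> ` unit_cube"
    unfolding max_value_def
    by (intro Greatest_mem_compact compact_continuous_image assms(1) compact_unit_cube)
       (simp add: unit_cube_nonempty)
  moreover have "connected (\<xi> ` unit_cube)"
    by (intro connected_continuous_image assms(1) connected_unit_cube)
  ultimately show ?thesis
    using assms(2,3) connected_contains_Icc by blast
qed

text \<open>The level set is closed in the compact cube, so \<open>f\<close> maps it to a compact
  set, which is nonempty because \<open>t\<close> is a value of \<open>\<xi>\<close>.\<close>

lemma
  assumes "continuous_on unit_cube f" and "continuous_on unit_cube \<xi>" and "t \<in> \<xi> ` unit_cube"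
  shows h_attained: "\<exists>y\<in>unit_cube. \<xi> y = t \<and> f y = h f \<xi> t"
    and h_upper: "\<And>x. x \<in> unit_cube \<Longrightarrow> \<xi> x = t \<Longrightarrow> f x \<le> h f \<xi> t"
proof -
  let ?L = "{x \<in> unit_cube. \<xi> x = t}"
  have "closed ?L"
    using continuous_closed_preimage_constant[OF assms(2) compact_imp_closed[OF compact_unit_cube]] .
  then have "compact (unit_cube \<inter> ?L)"
    using compact_unit_cube by (rule compact_Int_closed[rotated])
  moreover have "unit_cube \<inter> ?L = ?L" by blast
  ultimately have "compact ?L" by simp
  then have c: "compact (f ` ?L)"
    by (rule compact_continuous_image[OF continuous_on_subset[OF assms(1)], rotated]) blast
  have ne: "f ` ?L \<noteq> {}" using assms(3) by blast
  show "\<exists>y\<in>unit_cube. \<xi> y = t \<and> f y = h f \<xi> t"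
    using Greatest_mem_compact[OF c ne] unfolding h_def by force
  show "f x \<le> h f \<xi> t" if "x \<in> unit_cube" "\<xi> x = t" for x
    using Greatest_upper_compact[OF c ne] that unfolding h_def by blast
qed

theorem proposition2:
  fixes f \<xi> :: "real ^ 'n \<Rightarrow> real"
    and xs :: "real ^ 'n"
    and s_l s_u \<theta> :: real
    and I :: "real set"
  assumes "continuous_on unit_cube f"
    and "bounded (f ` unit_cube)"
    and "continuous_on unit_cube \<xi>"
    and "is_minimizer_on unit_cube \<xi> xs"
    and "\<And>y. is_minimizer_on unit_cube \<xi> y \<Longrightarrow> y = xs"
    and "s_l = \<xi> xs"
    and "s_u = max_value \<xi>"
    and "is_interval I"
    and "I \<subseteq> {s_l..s_u}"
    and "strictly_convex_on I (h f \<xi>)"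
    and "\<theta> \<in> interior I"
  shows "\<forall>lam>0. \<not> (\<exists>x. is_maximizer_on unit_cube (g f \<xi> lam) x \<and> \<xi> x = \<theta>)"
proof (intro allI impI notI)
  fix lam :: real
  assume "\<exists>x. is_maximizer_on unit_cube (g f \<xi> lam) x \<and> \<xi> x = \<theta>"
  then obtain x where x: "x \<in> unit_cube" "\<xi> x = \<theta>"
    and max: "\<And>y. y \<in> unit_cube \<Longrightarrow> g f \<xi> lam y \<le> g f \<xi> lam x"
    unfolding is_maximizer_on_def by blast
  have "xs \<in> unit_cube"
    using assms(4) unfolding is_minimizer_on_def by blast
  then have level: "t \<in> \<xi> ` unit_cube" if "t \<in> I" for t
    using level_nonempty[OF assms(3)] assms(6,7,9) that by blast
  have "\<theta> \<in> I" using assms(11) interior_subset by blast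
  have majorant: "h f \<xi> t \<le> h f \<xi> \<theta> + lam * (t - \<theta>)" if t: "t \<in> I" for t
  proof -
    obtain y where y: "y \<in> unit_cube" "\<xi> y = t" "f y = h f \<xi> t"
      using h_attained[OF assms(1,3) level[OF t]] by blast
    \<comment> \<open>Maximality of \<open>x\<close> against \<open>y\<close> reads
      \<open>h f \<xi> t - lam * t \<le> f x - lam * \<theta>\<close>, and
      \<open>f x \<le> h f \<xi> \<theta>\<close>.\<close>
    show ?thesis
      using max[OF y(1)] h_upper[OF assms(1,3) level[OF \<open>\<theta> \<in> I\<close>] x] x y
      by (simp add: g_def algebra_simps)
  qed
  obtain e where e: "e > 0" "cball \<theta> e \<subseteq> I"
    using assms(11) by (auto simp: mem_interior_cball)
  then have I: "\<theta> - e \<in> I" "\<theta> + e \<in> I"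
    by (auto simp: dist_real_def subset_iff)
  have "\<theta> - e \<noteq> \<theta> + e" using e(1) by simp
  with I assms(10)
  have "h f \<xi> ((1 - 1/2) * (\<theta> - e) + 1/2 * (\<theta> + e))
      < (1 - 1/2) * h f \<xi> (\<theta> - e) + 1/2 * h f \<xi> (\<theta> + e)"
    unfolding strictly_convex_on_def by (smt (verit) field_sum_of_halves half_gt_zero)
  moreover have "(1 - 1/2) * (\<theta> - e) + 1/2 * (\<theta> + e) = \<theta>"
    by (simp add: field_simps)
  \<comment> \<open>Averaging the two majorants cancels the slope terms \<open>- lam * e\<close> and
    \<open>lam * e\<close>, leaving \<open>h f \<xi> \<theta> < h f \<xi> \<theta>\<close>.\<close>
  ultimately show False
    using majorant[OF I(1)] majorant[OF I(2)] by (simp add: field_simps)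
qed

end
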